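(* Let $G$ be a two-dimensional graph with associated adjacency matrices $H$ and $V$. If $H$ and $V$ are irreducible permutation matrices, then $HV=VH$ if and only if $X_G\neq\emptyset$.
   Context: A two-dimensional graph is a pair $G=(H,V)$ of directed graphs (at most one edge for each ordered pair of vertices, loops allowed) on a common finite nonempty vertex set $\mathcal{V}$; $H$ and $V$ also denote their $0$-$1$ adjacency matrices indexed by $\mathcal{V}$. The shift space generated by $G$ is $$X_G=\{x\in\mathcal{V}^{\mathbb{Z}^2}: H_{x(i,j),x(i+1,j)}=1 \text{ and } V_{x(i,j),x(i,j+1)}=1 \text{ for all } (i,j)\in\mathbb{Z}^2\}.$$ A nonnegative square matrix $A$ is irreducible if for all indices $i,j$ there is $n\ge 1$ with $(A^n)_{ij}>0$. *)

theory Defs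
  imports "HOL-Analysis.Analysis"
begin

(* A directed graph with loops allowed and at most one edge per ordered pair is a binary
   relation.  Class finite on 'v (imposed with the adjacency matrices) makes the vertex set
   the finite nonempty set UNIV :: 'v set. *)
record 'v two_dim_graph =
  horizontal :: "'v rel"
  vertical :: "'v rel"

definition adjacency_matrix :: "'v rel \<Rightarrow> real ^ 'v ^ 'v::finite" where
  "adjacency_matrix E = (\<chi> u v. if (u, v) \<in> E then 1 else 0)"

definition H_matrix :: "'v two_dim_graph \<Rightarrow> real ^ 'v ^ 'v::finite" where
  "H_matrix G = adjacency_matrix (horizontal G)"

definition V_matrix :: "'v two_dim_graph \<Rightarrow> real ^ 'v ^ 'v::finite" where
  "V_matrix G = adjacency_matrix (vertical G)"

definition shift_space :: "'v::finite two_dim_graph \<Rightarrow> (int \<times> int \<Rightarrow> 'v) set" where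
  "shift_space G = {x. \<forall>i j. H_matrix G $ x (i, j) $ x (i + 1, j) = 1 \<and>
                            V_matrix G $ x (i, j) $ x (i, j + 1) = 1}"

(* The power operation ^ on real ^ 'n ^ 'n is componentwise, not the matrix power. *)
fun matrix_power :: "real ^ 'n ^ 'n \<Rightarrow> nat \<Rightarrow> real ^ 'n ^ 'n::finite" where
  "matrix_power A 0 = mat 1"
| "matrix_power A (Suc n) = A ** matrix_power A n"

definition irreducible_matrix :: "real ^ 'n ^ 'n::finite \<Rightarrow> bool" where
  "irreducible_matrix A \<longleftrightarrow>
     (\<forall>i j. A $ i $ j \<ge> 0) \<and> (\<forall>i j. \<exists>n\<ge>1. matrix_power A n $ i $ j > 0)"

definition permutation_matrix :: "real ^ 'n ^ 'n::finite \<Rightarrow> bool" where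
  "permutation_matrix A \<longleftrightarrow>
     (\<forall>i j. A $ i $ j \<in> {0, 1}) \<and>
     (\<forall>i. \<exists>!j. A $ i $ j = 1) \<and> (\<forall>j. \<exists>!i. A $ i $ j = 1)"

end

theory Submission
  imports Defs
begin

text \<open>
  A permutation matrix is the graph of a self-map of the vertex set, so write \<open>h\<close> and \<open>v\<close> for the
  maps of \<open>H\<close> and \<open>V\<close>. A point of the shift space is a configuration \<open>x\<close> in which a step to the
  right applies \<open>h\<close> and a step up applies \<open>v\<close>, and \<open>HV = VH\<close> says that \<open>h\<close> and \<open>v\<close> commute.
  Irreducibility of \<open>H\<close> says that \<open>h\<close> is a single cycle: the iterates of \<open>h\<close> carry every vertex to
  every vertex.

  If a point \<open>x\<close> exists, the two ways around a unit square show that \<open>h\<close> and \<open>v\<close> commute at every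
  vertex that occurs in \<open>x\<close>. Since \<open>h\<close> is a single cycle, the row of \<open>x\<close> through the origin already
  contains all vertices.

  Conversely, a map that commutes with a single cycle is one of its powers: if \<open>v\<close> agrees with
  \<open>h ^^ k\<close> at one vertex, then it does so along the whole cycle. A configuration that follows the
  cycle, advancing by \<open>1\<close> with each step to the right and by \<open>k\<close> with each step up, is therefore a
  point of the shift space.
\<close>

definition function_matrix :: "('n \<Rightarrow> 'n) \<Rightarrow> real ^ 'n ^ 'n::finite" where
  "function_matrix f = (\<chi> u w. if w = f u then 1 else 0)"

lemma function_matrix_nth: "function_matrix f $ u $ w = (if w = f u then 1 else 0)"
  by (simp add: function_matrix_def)

lemma permutation_matrix_imp_function_matrix:
  assumes "permutation_matrix A"
  obtains f where "A = function_matrix f"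
proof -
  from assms have ex1: "\<And>i. \<exists>!j. A $ i $ j = 1" and entries: "\<And>i j. A $ i $ j \<in> {0, 1}"
    by (auto simp: permutation_matrix_def)
  from ex1 obtain f where f: "\<And>i j. A $ i $ j = 1 \<longleftrightarrow> j = f i"
    by metis
  have "A $ i $ j = (if j = f i then 1 else 0)" for i j
    using f[of i j] entries[of i j] by auto
  then show thesis
    by (intro that[of f]) (simp add: function_matrix_def vec_eq_iff)
qed

text \<open>Multiplying by a function matrix on the left pulls rows back along the map, so a product of
  function matrices belongs to the composition in reverse order.\<close>

lemma function_matrix_mult_nth: "(function_matrix f ** B) $ u $ w = B $ f u $ w"
proof -
  have "(function_matrix f ** B) $ u $ w = (\<Sum>k\<in>UNIV. if k = f u then B $ k $ w else 0)"
    by (simp add: matrix_matrix_mult_def function_matrix_nth if_distrib[of "\<lambda>c. c * _"] cong: if_cong)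
  then show ?thesis
    by simp
qed

lemma function_matrix_mult: "function_matrix f ** function_matrix g = function_matrix (g \<circ> f)"
  by (simp add: vec_eq_iff function_matrix_mult_nth function_matrix_nth)

lemma function_matrix_eq_iff: "function_matrix f = function_matrix g \<longleftrightarrow> f = g"
proof
  assume eq: "function_matrix f = function_matrix g"
  have "f u = g u" for u
    using arg_cong[OF eq, of "\<lambda>A. A $ u $ f u"] by (simp add: function_matrix_nth split: if_splits)
  then show "f = g" ..
qed simp

lemma matrix_power_function_matrix: "matrix_power (function_matrix f) n = function_matrix (f ^^ n)"
proof (induction n)
  case 0
  show ?case
    by (auto simp: vec_eq_iff function_matrix_nth mat_def)
next
  case (Suc n)
  then show ?case
    by (simp only: matrix_power.simps function_matrix_mult funpow_Suc_right)
qed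

lemma irreducible_function_matrix_iff:
  "irreducible_matrix (function_matrix f) \<longleftrightarrow> (\<forall>u w. \<exists>n\<ge>1. w = (f ^^ n) u)"
  by (auto simp: irreducible_matrix_def matrix_power_function_matrix function_matrix_nth)

lemma mem_shift_space_iff:
  assumes "H_matrix G = function_matrix h" and "V_matrix G = function_matrix v"
  shows "x \<in> shift_space G \<longleftrightarrow>
           (\<forall>i j. x (i + 1, j) = h (x (i, j)) \<and> x (i, j + 1) = v (x (i, j)))"
  by (auto simp: shift_space_def assms function_matrix_nth split: if_splits)

lemma funpow_commute_point:
  assumes "h \<circ> v = v \<circ> h"
  shows "v ((h ^^ n) a) = (h ^^ n) (v a)"
  using fun_cong[OF assms] by (induction n) (simp_all, metis comp_apply)

text \<open>The centralizer of a cyclic map consists of its powers: commutation propagates the equation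
  \<open>v a = (h ^^ k) a\<close> from one vertex \<open>a\<close> along the cycle.\<close>

lemma commuting_with_cycle_is_power:
  assumes cyclic: "\<And>u w. \<exists>n\<ge>1. w = (h ^^ n) u" and comm: "h \<circ> v = v \<circ> h"
  obtains k where "v = h ^^ k"
proof -
  fix a
  obtain k where k: "v a = (h ^^ k) a"
    using cyclic by blast
  have "v u = (h ^^ k) u" for u
  proof -
    obtain n where u: "u = (h ^^ n) a"
      using cyclic by blast
    have "v u = (h ^^ n) ((h ^^ k) a)"
      by (simp add: u funpow_commute_point[OF comm] k)
    also have "\<dots> = (h ^^ k) u"
      by (simp add: u add.commute flip: comp_apply[of "h ^^ _" "h ^^ _"] funpow_add)
    finally show ?thesis .
  qed
  then show thesis
    by (intro that[of k]) auto
qed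

text \<open>A periodic forward orbit extends to a two-sided one by reading exponents modulo the period, so
  no inverse map is involved.\<close>

lemma periodic_orbit_shift:
  assumes "p \<ge> 1" and period: "(h ^^ p) a = a"
  shows "(h ^^ nat ((i + int k) mod int p)) a = (h ^^ k) ((h ^^ nat (i mod int p)) a)"
proof -
  define m where "m = nat (i mod int p)"
  have "int m = i mod int p"
    using \<open>p \<ge> 1\<close> by (simp add: m_def)
  then have "(i + int k) mod int p = int ((k + m) mod p)"
    by (simp add: zmod_int mod_simps add.commute)
  then have "(h ^^ nat ((i + int k) mod int p)) a = (h ^^ (k + m)) a"
    by (simp add: funpow_mod_eq[OF period])
  then show ?thesis
    by (simp add: m_def funpow_add)
qed

lemma shift_space_nonempty_if_commute:
  assumes H: "H_matrix G = function_matrix h" and V: "V_matrix G = function_matrix v"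
    and cyclic: "\<And>u w. \<exists>n\<ge>1. w = (h ^^ n) u" and comm: "h \<circ> v = v \<circ> h"
  shows "shift_space G \<noteq> {}"
proof -
  obtain k where v: "v = h ^^ k"
    using commuting_with_cycle_is_power[OF cyclic comm] .
  fix a
  obtain p where p: "p \<ge> 1" "(h ^^ p) a = a"
    using cyclic[of a a] by auto
  define y where "y i = (h ^^ nat (i mod int p)) a" for i
  have y_shift: "y (i + int n) = (h ^^ n) (y i)" for i n
    unfolding y_def by (rule periodic_orbit_shift[OF p])
  define x where "x = (\<lambda>(i, j). y (i + int k * j))"
  have "x (i + 1, j) = h (x (i, j))" for i j
    using y_shift[of "i + int k * j" 1] by (simp add: x_def algebra_simps)
  moreover have "x (i, j + 1) = v (x (i, j))" for i j
    using y_shift[of "i + int k * j" k] by (simp add: x_def v algebra_simps)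
  ultimately have "x \<in> shift_space G"
    by (simp add: mem_shift_space_iff[OF H V])
  then show ?thesis
    by blast
qed

lemma commute_if_shift_space_nonempty:
  assumes H: "H_matrix G = function_matrix h" and V: "V_matrix G = function_matrix v"
    and cyclic: "\<And>u w. \<exists>n\<ge>1. w = (h ^^ n) u" and x: "x \<in> shift_space G"
  shows "h \<circ> v = v \<circ> h"
proof
  fix w
  have right: "x (i + 1, j) = h (x (i, j))" and up: "x (i, j + 1) = v (x (i, j))" for i j
    using x by (simp_all add: mem_shift_space_iff[OF H V])
  have row: "x (int n, 0) = (h ^^ n) (x (0, 0))" for n
    by (induction n) (simp_all add: right add.commute[of 1])
  obtain n where w: "w = x (int n, 0)"
    using cyclic row by metis
  \<comment> \<open>Both sides are the upper right corner of the unit square with lower left corner \<open>(n, 0)\<close>.\<close>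
  have "h (v w) = x (int n + 1, 0 + 1)"
    unfolding right unfolding w up ..
  also have "\<dots> = v (h w)"
    unfolding up unfolding w right ..
  finally show "(h \<circ> v) w = (v \<circ> h) w"
    by simp
qed

theorem proposition6:
  fixes G :: "'v::finite two_dim_graph"
  assumes "permutation_matrix (H_matrix G)" and "irreducible_matrix (H_matrix G)"
    and "permutation_matrix (V_matrix G)" and "irreducible_matrix (V_matrix G)"
  shows "H_matrix G ** V_matrix G = V_matrix G ** H_matrix G \<longleftrightarrow> shift_space G \<noteq> {}"
proof -
  obtain h where H: "H_matrix G = function_matrix h"
    using permutation_matrix_imp_function_matrix[OF assms(1)] .
  obtain v where V: "V_matrix G = function_matrix v"
    using permutation_matrix_imp_function_matrix[OF assms(3)] .
  have cyclic: "\<exists>n\<ge>1. w = (h ^^ n) u" for u w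
    using assms(2) by (simp add: H irreducible_function_matrix_iff)
  have "H_matrix G ** V_matrix G = V_matrix G ** H_matrix G \<longleftrightarrow> h \<circ> v = v \<circ> h"
    by (auto simp: H V function_matrix_mult function_matrix_eq_iff)
  also have "\<dots> \<longleftrightarrow> shift_space G \<noteq> {}"
    using shift_space_nonempty_if_commute[OF H V cyclic]
      commute_if_shift_space_nonempty[OF H V cyclic] by blast
  finally show ?thesis .
qed

end
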